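(* Let $m,k\geq 2$ be relatively prime integers, and let $r$ be the least nonnegative residue of $m$ modulo $k$. If $n=m-\lfloor m/k\rfloor+F(k,k-r)$, then there exists a smooth arithmetical structure on $D_n$ whose critical group has order $m$.
   Context: For $n\ge 3$ let $\ell=n-3$. The bident $D_n$ has vertices $v_x,v_y,v_0,\dots,v_\ell$ and edges $v_xv_0$, $v_yv_0$, $v_iv_{i+1}$ ($0\le i\le\ell-1$). An arithmetical structure on $D_n$ is a pair $(\mathbf d,\mathbf r)$, $\mathbf d=(d_x,d_y,d_0,\dots,d_\ell)$, of positive integer vectors with $(\operatorname{diag}(\mathbf d)-A)\mathbf r=\mathbf 0$ ($A$ the adjacency matrix) and $\mathbf r$ primitive; it is smooth if $d_x,d_y,d_1,\dots,d_\ell\ge2$. Its critical group is the torsion part of $\mathbb Z^n/\operatorname{Im}(\operatorname{diag}(\mathbf d)-A)$. The function $F:\mathbb Z_{>0}\times\mathbb Z_{\ge0}\to\mathbb Z_{>0}$: given $x_1>0$, $x_2\ge0$, for each $i\ge2$ with $x_i>0$ let $x_{i+1}$ be the least nonnegative residue of $-x_{i-1}$ modulo $x_i$; $F(x_1,x_2)$ is the number of positive terms of $(x_i)$. *)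

theory Defs
  imports Main "HOL-Algebra.Product_Groups" "HOL-Algebra.Coset"
begin

datatype bident_vertex = VX | VY | VP nat

text \<open>The graph \<open>D\<^sub>n\<close> is meant for \<open>n \<ge> 3\<close>; its tail is \<open>VP 0, \<dots>, VP \<ell>\<close> with \<open>\<ell> = n - 3\<close>.\<close>

definition bident_verts :: "nat \<Rightarrow> bident_vertex set" where
  "bident_verts n = {VX, VY} \<union> VP ` {0..n - 3}"

definition bident_edges :: "nat \<Rightarrow> bident_vertex set set" where
  "bident_edges n = {{VX, VP 0}, {VY, VP 0}} \<union> {{VP i, VP (i + 1)} | i. i < n - 3}"

text \<open>Integer vectors and square matrices indexed by a vertex set \<open>V\<close> are functions of one or two
  vertex arguments; only their values on \<open>V\<close> matter.\<close>

definition adjacency :: "'v set set \<Rightarrow> 'v \<Rightarrow> 'v \<Rightarrow> int" where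
  "adjacency E u v = (if {u, v} \<in> E then 1 else 0)"

definition diag_minus_adjacency :: "'v set set \<Rightarrow> ('v \<Rightarrow> int) \<Rightarrow> 'v \<Rightarrow> 'v \<Rightarrow> int" where
  "diag_minus_adjacency E d u v = (if u = v then d u else 0) - adjacency E u v"

definition mat_vec :: "'v set \<Rightarrow> ('v \<Rightarrow> 'v \<Rightarrow> int) \<Rightarrow> ('v \<Rightarrow> int) \<Rightarrow> 'v \<Rightarrow> int" where
  "mat_vec V M x = (\<lambda>u\<in>V. \<Sum>v\<in>V. M u v * x v)"

definition arithmetical_structure ::
    "'v set \<Rightarrow> 'v set set \<Rightarrow> ('v \<Rightarrow> int) \<Rightarrow> ('v \<Rightarrow> int) \<Rightarrow> bool" where
  "arithmetical_structure V E d r \<longleftrightarrow>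
     (\<forall>v\<in>V. d v > 0) \<and> (\<forall>v\<in>V. r v > 0) \<and>
     (\<forall>v\<in>V. mat_vec V (diag_minus_adjacency E d) r v = 0) \<and>
     Gcd (r ` V) = 1"

text \<open>No condition is imposed on the value of \<open>d\<close> at the branching vertex \<open>VP 0\<close>.\<close>

definition smooth_bident_structure ::
    "nat \<Rightarrow> (bident_vertex \<Rightarrow> int) \<Rightarrow> (bident_vertex \<Rightarrow> int) \<Rightarrow> bool" where
  "smooth_bident_structure n d r \<longleftrightarrow>
     arithmetical_structure (bident_verts n) (bident_edges n) d r \<and>
     d VX \<ge> 2 \<and> d VY \<ge> 2 \<and> (\<forall>i\<in>{1..n - 3}. d (VP i) \<ge> 2)"

definition torsion_part :: "('a, 'b) monoid_scheme \<Rightarrow> ('a, 'b) monoid_scheme" where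
  "torsion_part G =
     G\<lparr>carrier := {x \<in> carrier G. \<exists>j::nat. j > 0 \<and> x [^]\<^bsub>G\<^esub> j = \<one>\<^bsub>G\<^esub>}\<rparr>"

definition int_vectors :: "'v set \<Rightarrow> ('v \<Rightarrow> int) monoid" where
  "int_vectors V = product_group V (\<lambda>_. integer_group)"

definition critical_group ::
    "'v set \<Rightarrow> 'v set set \<Rightarrow> ('v \<Rightarrow> int) \<Rightarrow> ('v \<Rightarrow> int) set monoid" where
  "critical_group V E d =
     torsion_part
       (int_vectors V Mod (mat_vec V (diag_minus_adjacency E d) ` carrier (int_vectors V)))"

text \<open>The sequence \<open>x\<^sub>1, x\<^sub>2, \<dots>\<close>, indexed from 0 and continued by 0 after its first zero term.\<close>

fun residue_seq :: "nat \<Rightarrow> nat \<Rightarrow> nat \<Rightarrow> int" where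
  "residue_seq a b 0 = int a"
| "residue_seq a b (Suc 0) = int b"
| "residue_seq a b (Suc (Suc i)) =
     (if residue_seq a b (Suc i) > 0
      then (- residue_seq a b i) mod residue_seq a b (Suc i) else 0)"

definition F :: "nat \<Rightarrow> nat \<Rightarrow> nat" where
  "F a b = card {i. residue_seq a b i > 0}"

end

theory Submission
  imports Defs
begin

text \<open>
  Put \<open>\<rho>\<^sub>x = k - 1\<close>, \<open>\<rho>\<^sub>y = 1\<close>, \<open>\<rho>\<^sub>0 = m (k - 1)\<close> and let \<open>\<rho>\<close> decrease along the tail in steps of \<open>k\<close>
  for as long as it stays positive. This yields \<open>m - \<lfloor>m/k\<rfloor>\<close> terms, ending in \<open>k - r\<close>; from there on the
  tail follows the residue sequence of \<open>(k, k - r)\<close>, which ends in 1 by coprimality.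

  In the cokernel, the tail relations give \<open>e\<^sub>i = \<rho>\<^sub>i e\<^sub>\<ell>\<close> as \<open>\<rho>\<^sub>\<ell> = 1\<close>, and the relation at the branching vertex
  gives \<open>e\<^sub>x + e\<^sub>y = (\<rho>\<^sub>x + 1) e\<^sub>\<ell>\<close>. What remains is generated by \<open>e\<^sub>\<ell>\<close> and \<open>\<tau> = e\<^sub>x - \<rho>\<^sub>x e\<^sub>\<ell>\<close> with the single
  relation \<open>d\<^sub>x \<tau> = 0\<close>, so the torsion part is cyclic of order \<open>d\<^sub>x = m\<close>.
\<close>

section \<open>Torsion in a quotient of a commutative group\<close>

text \<open>The hypotheses make the class of \<open>t\<close> an element of order exactly
  \<open>m\<close> whose powers exhaust the torsion classes. The torsion part is thus cyclic, listed
  without repetition by the cosets of \<open>t [^] i\<close> for \<open>i < m\<close>.\<close>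

lemma (in comm_group) order_torsion_part_Mod:
  assumes H: "subgroup H G" and t: "t \<in> carrier G" and m: "m > 0"
    and pow_mem: "\<And>i::nat. t [^] i \<in> H \<longleftrightarrow> m dvd i"
    and torsion: "\<And>w j. w \<in> carrier G \<Longrightarrow> (j::nat) > 0 \<Longrightarrow> w [^] j \<in> H
                    \<Longrightarrow> \<exists>i::nat. w \<otimes> inv (t [^] i) \<in> H"
  shows "order (torsion_part (G Mod H)) = m"
proof -
  have N: "normal H G" using H by (simp add: subgroup_imp_normal)
  interpret H: normal H G by (fact N)
  have coset_eq: "H #> a = H #> b \<longleftrightarrow> a \<otimes> inv b \<in> H"
    if "a \<in> carrier G" "b \<in> carrier G" for a b
    using that H H.rcos_module[OF is_group] by (metis repr_independence rcos_self)
  have pow: "(H #> a) [^]\<^bsub>G Mod H\<^esub> (j::nat) = H #> (a [^] j)" if "a \<in> carrier G" for a j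
  proof (induction j)
    case 0 then show ?case using H by (simp add: FactGroup_def subgroup.subset coset_mult_one)
  next
    case (Suc j) then show ?case using that by (simp add: FactGroup_def H.rcos_sum)
  qed
  have one: "H #> a = \<one>\<^bsub>G Mod H\<^esub> \<longleftrightarrow> a \<in> H" if "a \<in> carrier G" for a
    using that coset_eq[of a \<one>] H by (simp add: FactGroup_def subgroup.subset coset_mult_one)
  have inj: "inj_on (\<lambda>i. H #> t [^] i) {..<m}"
  proof (rule linorder_inj_onI')
    fix i j assume ij: "i \<in> {..<m}" "j \<in> {..<m}" "i < j"
    have "t [^] (j - i) \<otimes> t [^] i = t [^] j" using ij t by (simp add: nat_pow_mult)
    then have "t [^] j \<otimes> inv (t [^] i) = t [^] (j - i)" using t by (metis inv_solve_right nat_pow_closed)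
    moreover have "\<not> m dvd (j - i)" using ij by (simp add: nat_dvd_not_less less_imp_diff_less)
    ultimately have "H #> t [^] j \<noteq> H #> t [^] i"
      using coset_eq[of "t [^] j" "t [^] i"] t pow_mem by simp
    then show "H #> t [^] i \<noteq> H #> t [^] j" by (rule not_sym)
  qed
  have "carrier (torsion_part (G Mod H)) = (\<lambda>i. H #> t [^] i) ` {..<m}" (is "?L = ?R")
  proof
    show "?L \<subseteq> ?R"
    proof
      fix c assume "c \<in> ?L"
      then obtain w j where w: "w \<in> carrier G" "c = H #> w" "(j::nat) > 0"
        "c [^]\<^bsub>G Mod H\<^esub> j = \<one>\<^bsub>G Mod H\<^esub>"
        by (auto simp: torsion_part_def FactGroup_def RCOSETS_def)
      then have "w [^] j \<in> H" using pow one by simp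
      then obtain i :: nat where i: "w \<otimes> inv (t [^] i) \<in> H" using torsion w by blast
      \<comment> \<open>Powers with exponent a multiple of \<open>m\<close> lie in \<open>H\<close>,
        so the exponent may be reduced below \<open>m\<close>.\<close>
      have "t [^] i = t [^] (m * (i div m)) \<otimes> t [^] (i mod m)"
        using t by (simp add: nat_pow_mult)
      then have "t [^] i \<otimes> inv (t [^] (i mod m)) = t [^] (m * (i div m))"
        using t by (metis inv_solve_right nat_pow_closed)
      also have "\<dots> \<in> H" using pow_mem by simp
      finally have "H #> t [^] i = H #> t [^] (i mod m)" using coset_eq t by simp
      moreover have "c = H #> t [^] i" using i coset_eq w t by simp
      ultimately show "c \<in> ?R" using m by auto
    qed
  next
    show "?R \<subseteq> ?L"
    proof
      fix c assume "c \<in> ?R"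
      then obtain i :: nat where c: "c = H #> t [^] i" by blast
      have "(t [^] i) [^] m \<in> H" using pow_mem t by (simp add: nat_pow_pow)
      then have "c [^]\<^bsub>G Mod H\<^esub> m = \<one>\<^bsub>G Mod H\<^esub>" using c pow one t by simp
      moreover have "c \<in> carrier (G Mod H)" using c t by (auto simp: FactGroup_def RCOSETS_def)
      ultimately show "c \<in> ?L" using m by (auto simp: torsion_part_def)
    qed
  qed
  then show ?thesis using inj by (simp add: order_def card_image)
qed

section \<open>The lattice spanned by the columns of a matrix\<close>

text \<open>Values outside \<open>V\<close> are left free, so members can be written as plain lambda
  terms; intersecting with the carrier recovers the image of the matrix.\<close>

definition column_lattice :: "'v set \<Rightarrow> ('v \<Rightarrow> 'v \<Rightarrow> int) \<Rightarrow> ('v \<Rightarrow> int) set" where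
  "column_lattice V M = {f. \<exists>z. \<forall>u\<in>V. f u = (\<Sum>v\<in>V. M u v * z v)}"

lemma column_lattice_cong:
  "f \<in> column_lattice V M \<Longrightarrow> (\<And>u. u \<in> V \<Longrightarrow> g u = f u) \<Longrightarrow> g \<in> column_lattice V M"
  by (auto simp: column_lattice_def)

lemma column_lattice_zero: "(\<And>u. u \<in> V \<Longrightarrow> f u = 0) \<Longrightarrow> f \<in> column_lattice V M"
  by (auto simp: column_lattice_def intro!: exI[of _ "\<lambda>_. 0"])

lemma column_lattice_lincomb:
  assumes "f \<in> column_lattice V M" "g \<in> column_lattice V M"
  shows "(\<lambda>u. a * f u + b * g u) \<in> column_lattice V M"
proof -
  obtain y z where yz: "\<forall>u\<in>V. f u = (\<Sum>v\<in>V. M u v * y v)" "\<forall>u\<in>V. g u = (\<Sum>v\<in>V. M u v * z v)"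
    using assms by (auto simp: column_lattice_def)
  show ?thesis unfolding column_lattice_def
    by (rule CollectI, rule exI[of _ "\<lambda>v. a * y v + b * z v"])
       (simp add: yz algebra_simps sum.distrib sum_distrib_left)
qed

lemma column_lattice_sum:
  "(\<And>i. i \<in> A \<Longrightarrow> f i \<in> column_lattice V M) \<Longrightarrow> (\<lambda>u. \<Sum>i\<in>A. c i * f i u) \<in> column_lattice V M"
proof (induction A rule: infinite_finite_induct)
  case (insert i A)
  then show ?case using column_lattice_lincomb[of "f i" V M "\<lambda>u. \<Sum>i\<in>A. c i * f i u" "c i" 1] by simp
qed (auto intro: column_lattice_zero)

lemma column_mem_column_lattice:
  assumes "finite V" "j \<in> V"
  shows "(\<lambda>u. M u j) \<in> column_lattice V M"
  unfolding column_lattice_def using assms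
  by (auto intro!: exI[of _ "\<lambda>v. of_bool (v = j)"] simp: sum.delta' of_bool_def if_distrib cong: if_cong)

lemma carrier_int_vectors: "carrier (int_vectors V) = (\<Pi>\<^sub>E v\<in>V. UNIV)"
  by (simp add: int_vectors_def)

lemma mult_int_vectors: "x \<otimes>\<^bsub>int_vectors V\<^esub> y = (\<lambda>v\<in>V. x v + y v)"
  by (simp add: int_vectors_def)

lemma one_int_vectors: "\<one>\<^bsub>int_vectors V\<^esub> = (\<lambda>v\<in>V. 0)"
  by (simp add: int_vectors_def)

lemma comm_group_int_vectors: "comm_group (int_vectors V)"
  unfolding int_vectors_def
  by (rule group.group_comm_groupI) (auto simp: add.commute)

lemma inv_int_vectors:
  "x \<in> carrier (int_vectors V) \<Longrightarrow> inv\<^bsub>int_vectors V\<^esub> x = (\<lambda>v\<in>V. - x v)"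
  by (simp add: int_vectors_def)

lemma pow_int_vectors:
  "x \<in> carrier (int_vectors V) \<Longrightarrow> x [^]\<^bsub>int_vectors V\<^esub> (j::nat) = (\<lambda>v\<in>V. int j * x v)"
  by (induction j) (auto simp: one_int_vectors mult_int_vectors algebra_simps intro: restrict_ext)

lemma mat_vec_image_eq:
  "mat_vec V M ` carrier (int_vectors V) = column_lattice V M \<inter> carrier (int_vectors V)"
proof (intro equalityI subsetI)
  fix w assume "w \<in> column_lattice V M \<inter> carrier (int_vectors V)"
  then obtain z where z: "\<forall>u\<in>V. w u = (\<Sum>v\<in>V. M u v * z v)" and w: "w \<in> (\<Pi>\<^sub>E v\<in>V. UNIV)"
    by (auto simp: column_lattice_def carrier_int_vectors)
  have "w = mat_vec V M (restrict z V)"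
    by (rule PiE_ext[OF w]) (auto simp: mat_vec_def z intro: sum.cong)
  then show "w \<in> mat_vec V M ` carrier (int_vectors V)" by (simp add: carrier_int_vectors)
qed (auto simp: column_lattice_def carrier_int_vectors mat_vec_def)

lemma subgroup_mat_vec_image:
  "subgroup (mat_vec V M ` carrier (int_vectors V)) (int_vectors V)"
proof -
  interpret comm_group "int_vectors V" by (rule comm_group_int_vectors)
  show ?thesis unfolding mat_vec_image_eq
  proof (rule subgroupI)
    have "\<one>\<^bsub>int_vectors V\<^esub> \<in> column_lattice V M \<inter> carrier (int_vectors V)"
      by (auto intro: column_lattice_zero simp: one_int_vectors carrier_int_vectors)
    then show "column_lattice V M \<inter> carrier (int_vectors V) \<noteq> {}" by blast
  next
    fix a b
    assume a: "a \<in> column_lattice V M \<inter> carrier (int_vectors V)"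
    show "inv\<^bsub>int_vectors V\<^esub> a \<in> column_lattice V M \<inter> carrier (int_vectors V)"
      using a by (auto simp: inv_int_vectors carrier_int_vectors
          intro: column_lattice_cong[OF column_lattice_lincomb[of a V M a "-1" 0]])
    assume b: "b \<in> column_lattice V M \<inter> carrier (int_vectors V)"
    show "a \<otimes>\<^bsub>int_vectors V\<^esub> b \<in> column_lattice V M \<inter> carrier (int_vectors V)"
      using a b by (auto simp: mult_int_vectors carrier_int_vectors
          intro: column_lattice_cong[OF column_lattice_lincomb[of a V M b 1 1]])
  qed auto
qed

section \<open>The critical group of an arithmetical structure on the bident\<close>

lemma finite_bident_verts: "finite (bident_verts n)"
  by (simp add: bident_verts_def)

lemma diag_minus_adjacency_sym: "diag_minus_adjacency E d u v = diag_minus_adjacency E d v u"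
  by (simp add: diag_minus_adjacency_def adjacency_def insert_commute)

text \<open>Indicators of vertices past the end of the tail vanish on \<open>bident_verts n\<close>,
  so the last vertex needs no separate row formula.\<close>

lemma diag_minus_adjacency_bident:
  assumes "n \<ge> 3" "v \<in> bident_verts n"
  shows "diag_minus_adjacency (bident_edges n) d VX v = d VX * of_bool (v = VX) - of_bool (v = VP 0)"
    and "diag_minus_adjacency (bident_edges n) d VY v = d VY * of_bool (v = VY) - of_bool (v = VP 0)"
    and "diag_minus_adjacency (bident_edges n) d (VP 0) v =
           d (VP 0) * of_bool (v = VP 0) - of_bool (v = VX) - of_bool (v = VY) - of_bool (v = VP 1)"
    and "Suc i \<le> n - 3 \<Longrightarrow> diag_minus_adjacency (bident_edges n) d (VP (Suc i)) v =
           d (VP (Suc i)) * of_bool (v = VP (Suc i)) - of_bool (v = VP i) - of_bool (v = VP (Suc (Suc i)))"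
  using assms
  by (auto simp: diag_minus_adjacency_def adjacency_def bident_edges_def bident_verts_def doubleton_eq_iff)

text \<open>Continuing the tail by 0 through \<open>t\<close> gives the last vertex the same
  three-term relation as the inner ones.\<close>

lemma mat_vec_bident:
  fixes d z :: "bident_vertex \<Rightarrow> int"
  assumes n: "n \<ge> 3"
  defines "L \<equiv> mat_vec (bident_verts n) (diag_minus_adjacency (bident_edges n) d)"
    and "t \<equiv> (\<lambda>i. if i \<le> n - 3 then z (VP i) else 0)"
  shows "L z VX = d VX * z VX - z (VP 0)"
    and "L z VY = d VY * z VY - z (VP 0)"
    and "L z (VP 0) = d (VP 0) * z (VP 0) - z VX - z VY - t 1"
    and "Suc i \<le> n - 3 \<Longrightarrow>
           L z (VP (Suc i)) = d (VP (Suc i)) * z (VP (Suc i)) - t i - t (Suc (Suc i))"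
proof -
  have mem: "VX \<in> bident_verts n" "VY \<in> bident_verts n" "VP i \<in> bident_verts n \<longleftrightarrow> i \<le> n - 3" for i
    by (auto simp: bident_verts_def)
  have delta: "(\<Sum>v\<in>bident_verts n. of_bool (v = a) * z v) = (if a \<in> bident_verts n then z a else 0)" for a
  proof -
    have "(\<Sum>v\<in>bident_verts n. of_bool (v = a) * z v) = (\<Sum>v\<in>bident_verts n. if v = a then z v else 0)"
      by (rule sum.cong) auto
    then show ?thesis by (simp add: finite_bident_verts)
  qed
  have L: "L z u = (\<Sum>v\<in>bident_verts n. f v * z v)"
    if "u \<in> bident_verts n"
      and "\<And>v. v \<in> bident_verts n \<Longrightarrow> diag_minus_adjacency (bident_edges n) d u v = f v" for u f
    using that by (simp add: L_def mat_vec_def)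
  note rows = diag_minus_adjacency_bident[OF n, where d = d]
  note simps = mem left_diff_distrib sum_subtractf mult.assoc sum_distrib_left[symmetric] delta t_def
  show "L z VX = d VX * z VX - z (VP 0)"
    by (subst L[OF _ rows(1)]) (simp_all add: simps)
  show "L z VY = d VY * z VY - z (VP 0)"
    by (subst L[OF _ rows(2)]) (simp_all add: simps)
  show "L z (VP 0) = d (VP 0) * z (VP 0) - z VX - z VY - t 1"
    by (subst L[OF _ rows(3)]) (simp_all add: simps)
  show "L z (VP (Suc i)) = d (VP (Suc i)) * z (VP (Suc i)) - t i - t (Suc (Suc i))" if "Suc i \<le> n - 3"
    using that by (subst L[OF _ rows(4)]) (simp_all add: simps)
qed

text \<open>The matrix is symmetric, so its kernel vector \<open>r\<close> is orthogonal to every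
  column and hence to the whole image.\<close>

lemma row_combination_zero:
  fixes r z :: "'v \<Rightarrow> int"
  assumes "\<forall>v\<in>V. mat_vec V (diag_minus_adjacency E d) r v = 0"
  shows "(\<Sum>u\<in>V. r u * (\<Sum>v\<in>V. diag_minus_adjacency E d u v * z v)) = 0"
proof -
  have "(\<Sum>u\<in>V. r u * (\<Sum>v\<in>V. diag_minus_adjacency E d u v * z v))
      = (\<Sum>v\<in>V. \<Sum>u\<in>V. r u * (diag_minus_adjacency E d u v * z v))"
    by (subst sum.swap) (simp add: sum_distrib_left)
  also have "\<dots> = (\<Sum>v\<in>V. z v * mat_vec V (diag_minus_adjacency E d) r v)"
    by (intro sum.cong refl)
       (simp add: mat_vec_def sum_distrib_left diag_minus_adjacency_sym mult.commute mult.left_commute)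
  also have "\<dots> = 0" using assms by simp
  finally show ?thesis .
qed

lemma sum_bident_verts:
  "(\<Sum>v\<in>bident_verts n. f v) = f VX + f VY + (\<Sum>i\<le>n - 3. f (VP i) :: int)"
proof -
  have "(\<Sum>v\<in>bident_verts n. f v) = (\<Sum>v\<in>{VX, VY}. f v) + (\<Sum>v\<in>VP ` {0..n - 3}. f v)"
    unfolding bident_verts_def by (rule sum.union_disjoint) auto
  also have "(\<Sum>v\<in>VP ` {0..n - 3}. f v) = (\<Sum>i\<le>n - 3. f (VP i))"
    by (subst sum.reindex) (auto simp: inj_on_def atMost_atLeast0)
  finally show ?thesis by simp
qed

section \<open>The cokernel when the entries at one leaf and at the end of the tail are 1\<close>

locale unit_leaf_bident_structure =
  fixes n :: nat and d r :: "bident_vertex \<Rightarrow> int"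
  assumes n: "n \<ge> 3"
    and arith: "arithmetical_structure (bident_verts n) (bident_edges n) d r"
    and unit_leaf: "r VY = 1"
    and unit_end: "r (VP (n - 3)) = 1"
begin

abbreviation "\<Lambda> \<equiv> column_lattice (bident_verts n) (diag_minus_adjacency (bident_edges n) d)"

lemma mem:
  "VX \<in> bident_verts n" "VY \<in> bident_verts n" "VP i \<in> bident_verts n \<longleftrightarrow> i \<le> n - 3"
  by (auto simp: bident_verts_def)

lemma kernel:
  "\<forall>v\<in>bident_verts n. mat_vec (bident_verts n) (diag_minus_adjacency (bident_edges n) d) r v = 0"
  using arith by (simp add: arithmetical_structure_def)

lemma r_VP_0: "r (VP 0) = d VX * r VX" "r (VP 0) = d VY"
  using kernel mat_vec_bident(1,2)[OF n, of d r] unit_leaf mem by auto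

lemma dX_pos: "d VX > 0"
  using arith mem by (simp add: arithmetical_structure_def)

text \<open>By symmetry a row is also a column, so the explicit row formulas can serve as relations
  in the cokernel.\<close>

lemma row_mem: "j \<in> bident_verts n \<Longrightarrow> diag_minus_adjacency (bident_edges n) d j \<in> \<Lambda>"
  using column_mem_column_lattice[OF finite_bident_verts, of j n "diag_minus_adjacency (bident_edges n) d"]
  by (simp add: diag_minus_adjacency_sym[of _ d _ j])

definition tail :: "nat \<Rightarrow> int" where
  "tail i = (if i \<le> n - 3 then r (VP i) else 0)"

text \<open>Induction from the end of the tail backwards. Two neighbouring indices are carried
  because the recurrence has order two; the base pair uses \<open>unit_end\<close> and the virtual
  vertex just past the end, where everything is 0.\<close>

lemma tail_reduction_pair:
  "j \<le> n - 3 \<Longrightarrow> \<forall>i \<in> {n - 3 - j, Suc (n - 3 - j)}.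
     (\<lambda>u. of_bool (u = VP i) - tail i * of_bool (u = VP (n - 3))) \<in> \<Lambda>"
proof (induction j)
  case 0
  have "of_bool (u = VP i) - tail i * of_bool (u = VP (n - 3)) = 0"
    if "i \<in> {n - 3, Suc (n - 3)}" "u \<in> bident_verts n" for i u
    using that mem unit_end by (auto simp: tail_def)
  then show ?case unfolding diff_zero by (intro ballI column_lattice_zero)
next
  case (Suc j)
  define i where "i = n - 3 - Suc j"
  have i: "n - 3 - j = Suc i" "Suc i \<le> n - 3" using Suc.prems by (auto simp: i_def)
  have IH: "(\<lambda>u. of_bool (u = VP (Suc i)) - tail (Suc i) * of_bool (u = VP (n - 3))) \<in> \<Lambda>"
    "(\<lambda>u. of_bool (u = VP (Suc (Suc i))) - tail (Suc (Suc i)) * of_bool (u = VP (n - 3))) \<in> \<Lambda>"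
    using Suc i by auto
  have rec: "d (VP (Suc i)) * tail (Suc i) = tail i + tail (Suc (Suc i))"
    using kernel mat_vec_bident(4)[OF n i(2), of d r] mem(3)[of "Suc i"] i by (auto simp: tail_def)
  have "VP (Suc i) \<in> bident_verts n" using i mem by simp
  then have A: "diag_minus_adjacency (bident_edges n) d (VP (Suc i)) \<in> \<Lambda>" by (rule row_mem)
  have "(\<lambda>u. of_bool (u = VP i) - tail i * of_bool (u = VP (n - 3))) \<in> \<Lambda>"
  \<comment> \<open>Row \<open>VP (Suc i)\<close> expresses the indicator of \<open>VP i\<close> by
    those of its two successors, and \<open>tail\<close> obeys the same recurrence.\<close>
  proof (rule column_lattice_cong[OF column_lattice_lincomb[OF
        column_lattice_lincomb[OF A IH(1), of "-1" "d (VP (Suc i))"] IH(2), of 1 "-1"]])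
    fix u assume u: "u \<in> bident_verts n"
    have t: "tail i = d (VP (Suc i)) * tail (Suc i) - tail (Suc (Suc i))" using rec by simp
    show "of_bool (u = VP i) - tail i * of_bool (u = VP (n - 3)) =
         1 * (- 1 * diag_minus_adjacency (bident_edges n) d (VP (Suc i)) u +
          d (VP (Suc i)) * (of_bool (u = VP (Suc i)) - tail (Suc i) * of_bool (u = VP (n - 3)))) +
         - 1 * (of_bool (u = VP (Suc (Suc i))) - tail (Suc (Suc i)) * of_bool (u = VP (n - 3)))"
      unfolding diag_minus_adjacency_bident(4)[OF n u i(2)] t by (simp add: algebra_simps)
  qed
  then show ?case unfolding i_def[symmetric] using IH(1) by blast
qed

lemma tail_reduction:
  "i \<le> Suc (n - 3) \<Longrightarrow> (\<lambda>u. of_bool (u = VP i) - tail i * of_bool (u = VP (n - 3))) \<in> \<Lambda>"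
  using tail_reduction_pair[of "n - 3 - i"] tail_reduction_pair[of 0]
  by (cases "i \<le> n - 3") (simp_all add: le_Suc_eq del: diff_diff_left)

text \<open>Inserting the tail reductions into row \<open>VP 0\<close> leaves the coefficient
  \<open>d (VP 0) * tail 0 - tail 1\<close>, which the kernel equation at \<open>VP 0\<close>
  identifies as the sum of the two leaf entries of \<open>r\<close>.\<close>

lemma leaf_reduction:
  "(\<lambda>u. of_bool (u = VY) + of_bool (u = VX) - (r VX + 1) * of_bool (u = VP (n - 3))) \<in> \<Lambda>"
proof -
  have A: "diag_minus_adjacency (bident_edges n) d (VP 0) \<in> \<Lambda>" using mem by (simp add: row_mem)
  have t: "r VX + 1 = d (VP 0) * tail 0 - tail 1"
    using kernel mat_vec_bident(3)[OF n, of d r] mem unit_leaf by (auto simp: tail_def)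
  have T: "(\<lambda>u. of_bool (u = VP 0) - tail 0 * of_bool (u = VP (n - 3))) \<in> \<Lambda>"
    "(\<lambda>u. of_bool (u = VP 1) - tail 1 * of_bool (u = VP (n - 3))) \<in> \<Lambda>"
    by (rule tail_reduction; simp)+
  show ?thesis
  proof (rule column_lattice_cong[OF column_lattice_lincomb[OF
        column_lattice_lincomb[OF A T(1), of "-1" "d (VP 0)"] T(2), of 1 "-1"]])
    fix u assume u: "u \<in> bident_verts n"
    show "of_bool (u = VY) + of_bool (u = VX) - (r VX + 1) * of_bool (u = VP (n - 3)) =
         1 * (- 1 * diag_minus_adjacency (bident_edges n) d (VP 0) u +
          d (VP 0) * (of_bool (u = VP 0) - tail 0 * of_bool (u = VP (n - 3)))) +
         - 1 * (of_bool (u = VP 1) - tail 1 * of_bool (u = VP (n - 3)))"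
      unfolding diag_minus_adjacency_bident(3)[OF n u] t by (simp add: algebra_simps)
  qed
qed

definition \<tau> :: "bident_vertex \<Rightarrow> int" where
  "\<tau> u = of_bool (u = VX) - r VX * of_bool (u = VP (n - 3))"

text \<open>The projection to the free part of the cokernel: it kills \<open>\<Lambda>\<close> and
  is 1 on the indicator of the end of the tail.\<close>

definition weight :: "(bident_vertex \<Rightarrow> int) \<Rightarrow> int" where
  "weight w = (\<Sum>u\<in>bident_verts n. r u * w u)"

text \<open>Modulo \<open>\<Lambda>\<close>, the indicator of \<open>VX\<close> is
  \<open>\<tau>\<close> plus \<open>r VX\<close> times that of the end, and by
  \<open>leaf_reduction\<close> the indicator of \<open>VY\<close> is that of the end minus
  \<open>\<tau>\<close>. Collecting terms gives both coefficients.\<close>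

lemma reduction:
  "(\<lambda>u. w u - (w VX - w VY) * \<tau> u - weight w * of_bool (u = VP (n - 3))) \<in> \<Lambda>"
proof -
  have S: "(\<lambda>u. \<Sum>i\<le>n - 3. w (VP i) * (of_bool (u = VP i) - tail i * of_bool (u = VP (n - 3)))) \<in> \<Lambda>"
    by (rule column_lattice_sum) (simp add: tail_reduction)
  show ?thesis
  proof (rule column_lattice_cong[OF column_lattice_lincomb[OF S leaf_reduction, of 1 "w VY"]])
    fix u assume u: "u \<in> bident_verts n"
    have W: "weight w = r VX * w VX + w VY + (\<Sum>i\<le>n - 3. w (VP i) * tail i)"
      by (simp add: weight_def sum_bident_verts unit_leaf tail_def mult.commute)
    have "w u = w VX * of_bool (u = VX) + w VY * of_bool (u = VY) +
        (\<Sum>i\<le>n - 3. w (VP i) * of_bool (u = VP i))"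
    proof (cases u)
      case (VP j)
      then have "(\<Sum>i\<le>n - 3. w (VP i) * of_bool (u = VP i)) = (\<Sum>i\<le>n - 3. if j = i then w (VP i) else 0)"
        by (intro sum.cong) auto
      then show ?thesis using VP u mem by simp
    qed simp_all
    then show "w u - (w VX - w VY) * \<tau> u - weight w * of_bool (u = VP (n - 3)) =
         1 * (\<Sum>i\<le>n - 3. w (VP i) * (of_bool (u = VP i) - tail i * of_bool (u = VP (n - 3)))) +
         w VY * (of_bool (u = VY) + of_bool (u = VX) - (r VX + 1) * of_bool (u = VP (n - 3)))"
      by (simp add: W \<tau>_def right_diff_distrib sum_subtractf sum_distrib_right algebra_simps)
  qed
qed

text \<open>Orthogonality to \<open>r\<close> gives the first claim. In the second, the two leaf
  rows are subtracted, \<open>z (VP 0)\<close> cancels, and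
  \<open>d VY = r (VP 0) = d VX * r VX\<close> supplies the common factor.\<close>

lemma lattice_necessary:
  assumes "w \<in> \<Lambda>"
  shows "weight w = 0" and "d VX dvd w VX - w VY"
proof -
  obtain z where z: "\<And>u. u \<in> bident_verts n \<Longrightarrow>
      w u = (\<Sum>v\<in>bident_verts n. diag_minus_adjacency (bident_edges n) d u v * z v)"
    using assms by (auto simp: column_lattice_def)
  show "weight w = 0" using row_combination_zero[OF kernel, of z] by (simp add: weight_def z)
  have "w VX = d VX * z VX - z (VP 0)" "w VY = d VY * z VY - z (VP 0)"
    using z mem mat_vec_bident(1,2)[OF n, of d z] by (auto simp: mat_vec_def)
  then have "w VX - w VY = d VX * (z VX - r VX * z VY)"
    using r_VP_0 by (simp add: algebra_simps)
  then show "d VX dvd w VX - w VY" by simp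
qed

text \<open>Row \<open>VX\<close> plus the reduction of \<open>VP 0\<close> to the end of the tail,
  where \<open>tail 0 = d VX * r VX\<close>.\<close>

lemma dX_tau_mem: "(\<lambda>u. d VX * \<tau> u) \<in> \<Lambda>"
proof -
  have A: "diag_minus_adjacency (bident_edges n) d VX \<in> \<Lambda>" using mem by (simp add: row_mem)
  have T: "(\<lambda>u. of_bool (u = VP 0) - tail 0 * of_bool (u = VP (n - 3))) \<in> \<Lambda>"
    by (rule tail_reduction) simp
  show ?thesis
  proof (rule column_lattice_cong[OF column_lattice_lincomb[OF A T, of 1 1]])
    fix u assume u: "u \<in> bident_verts n"
    show "d VX * \<tau> u = 1 * diag_minus_adjacency (bident_edges n) d VX u
        + 1 * (of_bool (u = VP 0) - tail 0 * of_bool (u = VP (n - 3)))"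
      unfolding diag_minus_adjacency_bident(1)[OF n u]
      by (simp add: \<tau>_def tail_def r_VP_0(1) right_diff_distrib)
  qed
qed

lemma lattice_iff: "w \<in> \<Lambda> \<longleftrightarrow> weight w = 0 \<and> d VX dvd w VX - w VY"
proof
  assume w: "weight w = 0 \<and> d VX dvd w VX - w VY"
  then obtain c where c: "w VX - w VY = d VX * c" by blast
  show "w \<in> \<Lambda>"
    by (rule column_lattice_cong[OF column_lattice_lincomb[OF reduction[of w] dX_tau_mem, of 1 c]])
       (simp add: w c)
qed (use lattice_necessary in blast)

lemma weight_cong: "(\<And>u. u \<in> bident_verts n \<Longrightarrow> w u = w' u) \<Longrightarrow> weight w = weight w'"
  by (simp add: weight_def)

lemma weight_scale: "weight (\<lambda>u. c * w u) = c * weight w"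
  by (simp add: weight_def sum_distrib_left mult.left_commute)

lemma weight_diff: "weight (\<lambda>u. w u - w' u) = weight w - weight w'"
  by (simp add: weight_def sum_subtractf right_diff_distrib)

lemma weight_tau: "weight \<tau> = 0"
proof -
  have "(\<Sum>i\<le>n - 3. r (VP i) * \<tau> (VP i)) = (\<Sum>i\<le>n - 3. if i = n - 3 then - r VX else 0)"
    by (intro sum.cong) (auto simp: \<tau>_def unit_end)
  then show ?thesis by (simp add: weight_def sum_bident_verts) (simp add: \<tau>_def)
qed

text \<open>Since \<open>weight\<close> is additive with integer values and vanishes on the lattice,
  a torsion class has weight 0. By \<open>lattice_iff\<close> only the difference of the leaf
  coordinates modulo \<open>d VX\<close> remains, and this is 1 on \<open>\<tau>\<close>.\<close>

theorem order_critical_group: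
  "order (critical_group (bident_verts n) (bident_edges n) d) = nat (d VX)"
proof -
  define V where "V = bident_verts n"
  define H where "H = mat_vec V (diag_minus_adjacency (bident_edges n) d) ` carrier (int_vectors V)"
  interpret G: comm_group "int_vectors V" by (rule comm_group_int_vectors)
  have H: "w \<in> H \<longleftrightarrow> weight w = 0 \<and> d VX dvd w VX - w VY" if "w \<in> carrier (int_vectors V)" for w
    using that by (simp add: H_def mat_vec_image_eq V_def lattice_iff)
  define t where "t = restrict \<tau> V"
  have t: "t \<in> carrier (int_vectors V)" by (simp add: t_def carrier_int_vectors)
  have tp: "t [^]\<^bsub>int_vectors V\<^esub> (i::nat) = (\<lambda>v\<in>V. int i * \<tau> v)" for i
    using pow_int_vectors[OF t] by (simp add: t_def cong: restrict_cong)
  have mV: "VX \<in> V" "VY \<in> V" using mem by (simp_all add: V_def)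
  have wr: "weight (restrict f V) = weight f" for f by (rule weight_cong) (simp add: V_def)
  have "order (torsion_part (int_vectors V Mod H)) = nat (d VX)"
  proof (rule G.order_torsion_part_Mod)
    show "subgroup H (int_vectors V)" by (simp add: H_def subgroup_mat_vec_image)
    show "t \<in> carrier (int_vectors V)" by (rule t)
    show "nat (d VX) > 0" using dX_pos by simp
  next
    fix i :: nat
    have "t [^]\<^bsub>int_vectors V\<^esub> i \<in> carrier (int_vectors V)" using t by simp
    then have "t [^]\<^bsub>int_vectors V\<^esub> i \<in> H \<longleftrightarrow> d VX dvd int i"
      by (simp add: H tp wr weight_scale weight_tau mV) (simp add: \<tau>_def)
    also have "\<dots> \<longleftrightarrow> nat (d VX) dvd i" using dX_pos by (simp add: nat_dvd_iff)
    finally show "t [^]\<^bsub>int_vectors V\<^esub> i \<in> H \<longleftrightarrow> nat (d VX) dvd i" .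
  next
    fix w and j :: nat
    assume w: "w \<in> carrier (int_vectors V)" and j: "j > 0" and "w [^]\<^bsub>int_vectors V\<^esub> j \<in> H"
    then have "weight (w [^]\<^bsub>int_vectors V\<^esub> j) = 0" using H by simp
    then have "weight (\<lambda>v\<in>V. int j * w v) = 0" by (simp only: pow_int_vectors[OF w])
    then have w0: "weight w = 0" using j by (simp add: wr weight_scale)
    \<comment> \<open>The exponent must be a natural number, hence the residue instead of the
      possibly negative difference.\<close>
    define i where "i = nat ((w VX - w VY) mod d VX)"
    have i: "int i = (w VX - w VY) mod d VX" using dX_pos by (simp add: i_def)
    have p: "t [^]\<^bsub>int_vectors V\<^esub> i \<in> carrier (int_vectors V)" using t by simp
    have e: "w \<otimes>\<^bsub>int_vectors V\<^esub> inv\<^bsub>int_vectors V\<^esub> (t [^]\<^bsub>int_vectors V\<^esub> i) = (\<lambda>v\<in>V. w v - int i * \<tau> v)"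
      unfolding inv_int_vectors[OF p] mult_int_vectors by (rule restrict_ext) (simp add: tp)
    have "weight (\<lambda>v\<in>V. w v - int i * \<tau> v) = 0"
      by (simp add: wr weight_diff weight_scale weight_tau w0)
    moreover have "d VX dvd (\<lambda>v\<in>V. w v - int i * \<tau> v) VX - (\<lambda>v\<in>V. w v - int i * \<tau> v) VY"
    proof -
      have "(\<lambda>v\<in>V. w v - int i * \<tau> v) VX - (\<lambda>v\<in>V. w v - int i * \<tau> v) VY = (w VX - w VY) - int i"
        by (simp add: mV) (simp add: \<tau>_def)
      then show ?thesis by (simp add: i dvd_minus_mod)
    qed
    ultimately have "(\<lambda>v\<in>V. w v - int i * \<tau> v) \<in> H" by (simp add: H carrier_int_vectors)
    then show "\<exists>i::nat. w \<otimes>\<^bsub>int_vectors V\<^esub> inv\<^bsub>int_vectors V\<^esub> (t [^]\<^bsub>int_vectors V\<^esub> i) \<in> H"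
      using e by metis
  qed
  then show ?thesis by (simp add: critical_group_def H_def V_def)
qed

end

section \<open>Structures from decreasing sequences\<close>

text \<open>The vector \<open>\<rho>\<close> has \<open>a\<close> and 1 at the leaves and
  \<open>s\<close> along the tail, and \<open>d\<close> is solved from the vertex relations:
  \<open>s0\<close> gives the value \<open>m\<close> at \<open>VX\<close>, \<open>s1\<close> gives 1
  at the branching vertex, \<open>dvd\<close> gives integers along the tail. Strict decrease yields
  smoothness there.\<close>

lemma smooth_bident_structure_from_sequence:
  fixes s :: "nat \<Rightarrow> int" and a m :: int
  assumes n: "n \<ge> 4" and a: "a > 0" and m: "m \<ge> 2"
    and s0: "s 0 = m * a" and s1: "s 0 = a + 1 + s 1"
    and pos: "\<And>i. i \<le> n - 3 \<Longrightarrow> s i > 0"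
    and decr: "\<And>i. i < n - 3 \<Longrightarrow> s (Suc i) < s i"
    and dvd: "\<And>i. i < n - 3 \<Longrightarrow> s (Suc i) dvd s i + s (Suc (Suc i))"
    and last: "s (n - 3) = 1" and zero: "s (Suc (n - 3)) = 0"
  shows "\<exists>d \<rho>. smooth_bident_structure n d \<rho> \<and>
           order (critical_group (bident_verts n) (bident_edges n) d) = nat m"
proof -
  define \<rho> where "\<rho> v = (case v of VX \<Rightarrow> a | VY \<Rightarrow> 1 | VP i \<Rightarrow> s i)" for v
  define d where "d v = (case v of VX \<Rightarrow> m | VY \<Rightarrow> s 0
      | VP 0 \<Rightarrow> 1 | VP (Suc i) \<Rightarrow> (s i + s (Suc (Suc i))) div s (Suc i))" for v
  have d_simps: "d VX = m" "d VY = s 0" "d (VP 0) = 1"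
    "d (VP (Suc i)) = (s i + s (Suc (Suc i))) div s (Suc i)" for i by (simp_all add: d_def)
  have \<rho>_simps: "\<rho> VX = a" "\<rho> VY = 1" "\<rho> (VP i) = s i" for i by (simp_all add: \<rho>_def)
  have d_eq: "d (VP (Suc i)) * s (Suc i) = s i + s (Suc (Suc i))" if "i < n - 3" for i
    using dvd[OF that] by (simp add: d_simps)
  have nonneg: "s i \<ge> 0" if "i \<le> Suc (n - 3)" for i
    using pos[of i] zero that by (cases "i = Suc (n - 3)") auto
  have d_ge: "d (VP (Suc i)) \<ge> 2" if i: "i < n - 3" for i
  proof (rule ccontr)
    \<comment> \<open>A value at most 1 would give
      \<open>s i + s (Suc (Suc i)) \<le> s (Suc i)\<close>, contrary to decrease and
      nonnegativity.\<close>
    assume "\<not> d (VP (Suc i)) \<ge> 2"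
    then have "d (VP (Suc i)) * s (Suc i) \<le> 1 * s (Suc i)"
      using pos[of "Suc i"] i by (intro mult_right_mono) auto
    then show False using d_eq[OF i] decr[OF i] nonneg[of "Suc (Suc i)"] i by simp
  qed
  have s0_ge: "s 0 \<ge> 2"
    using mult_mono[of 2 m 1 a] a m by (simp add: s0)
  have n3: "n \<ge> 3" using n by simp
  have cases: "P v" if "v \<in> bident_verts n" "P VX" "P VY" "P (VP 0)"
    "\<And>i. i < n - 3 \<Longrightarrow> P (VP (Suc i))" for P :: "bident_vertex \<Rightarrow> bool" and v
  proof -
    have "P (VP j)" if "j \<le> n - 3" for j
      using that \<open>P (VP 0)\<close> \<open>\<And>i. i < n - 3 \<Longrightarrow> P (VP (Suc i))\<close> by (cases j) auto
    then show ?thesis using that by (auto simp: bident_verts_def)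
  qed
  have "arithmetical_structure (bident_verts n) (bident_edges n) d \<rho>"
    unfolding arithmetical_structure_def
  proof (intro conjI ballI)
    fix v assume v: "v \<in> bident_verts n"
    show "d v > 0"
      by (rule cases[OF v]) (use m s0_ge d_ge in \<open>force simp: d_simps(1-3)\<close>)+
    show "\<rho> v > 0"
      by (rule cases[OF v]) (use a pos in \<open>auto simp: \<rho>_simps\<close>)
    show "mat_vec (bident_verts n) (diag_minus_adjacency (bident_edges n) d) \<rho> v = 0"
    proof (rule cases[OF v])
      fix i assume i: "i < n - 3"
      show "mat_vec (bident_verts n) (diag_minus_adjacency (bident_edges n) d) \<rho> (VP (Suc i)) = 0"
      proof (cases "Suc (Suc i) \<le> n - 3")
        case False
        then have "Suc (Suc i) = Suc (n - 3)" using i by simp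
        then have "s (Suc (Suc i)) = 0" using zero by simp
        then show ?thesis using False i d_eq[OF i]
          by (simp add: mat_vec_bident(4)[OF n3] \<rho>_simps)
      qed (use i d_eq[OF i] in \<open>simp add: mat_vec_bident(4)[OF n3] \<rho>_simps\<close>)
    qed (use n s0 s1 Suc_le_eq in \<open>simp_all add: mat_vec_bident(1-3)[OF n3] \<rho>_simps d_simps(1-3)\<close>)
  next
    have "Gcd (\<rho> ` bident_verts n) dvd \<rho> VY" by (rule Gcd_dvd) (simp add: bident_verts_def)
    then show "Gcd (\<rho> ` bident_verts n) = 1" by (simp add: \<rho>_simps)
  qed
  moreover from this have "unit_leaf_bident_structure n d \<rho>"
    using n last by unfold_locales (auto simp: \<rho>_simps)
  then have "order (critical_group (bident_verts n) (bident_edges n) d) = nat m"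
    using unit_leaf_bident_structure.order_critical_group d_simps(1) by fastforce
  moreover have "d (VP i) \<ge> 2" if "i \<in> {1..n - 3}" for i
    using that d_ge[of "i - 1"] by (cases i) auto
  ultimately show ?thesis using m s0_ge d_simps(1,2) unfolding smooth_bident_structure_def by metis
qed

section \<open>The residue sequence\<close>

lemma residue_seq_nonneg: "residue_seq a b i \<ge> 0"
  by (induction a b i rule: residue_seq.induct) auto

lemma residue_seq_decreasing:
  assumes "b < a" "residue_seq a b i > 0"
  shows "residue_seq a b (Suc i) < residue_seq a b i"
  using assms by (cases i) auto

lemma residue_seq_stays_zero:
  assumes "0 < b" "0 < a" "residue_seq a b i = 0"
  shows "residue_seq a b (Suc i) = 0"
  using assms by (cases i) auto

lemma residue_seq_bound: "b < a \<Longrightarrow> residue_seq a b i > 0 \<Longrightarrow> 0 < b \<Longrightarrow> residue_seq a b i + int i \<le> int a"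
proof (induction i)
  case (Suc i)
  have "residue_seq a b i > 0"
    using residue_seq_stays_zero[of b a i] residue_seq_nonneg[of a b i] Suc.prems by fastforce
  then show ?case using Suc residue_seq_decreasing[of b a i] by simp
qed simp

text \<open>Strict decrease makes the set of positive positions finite, and zeros persist, so it is
  an initial segment. Its cardinality is therefore the index of the first zero.\<close>

lemma residue_seq_pos_iff:
  assumes "0 < b" "b < a"
  shows "residue_seq a b i > 0 \<longleftrightarrow> i < F a b"
proof -
  let ?S = "{i. residue_seq a b i > 0}"
  have "?S \<subseteq> {..a}" using residue_seq_bound[of b a] assms by fastforce
  then have fin: "finite ?S" by (rule finite_subset) simp
  have down: "residue_seq a b j > 0" if "residue_seq a b i > 0" "j \<le> i" for i j
  proof (rule ccontr)
    assume "\<not> residue_seq a b j > 0"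
    then have j: "residue_seq a b j = 0" using residue_seq_nonneg[of a b j] by simp
    have "residue_seq a b (j + l) = 0" for l
      by (induction l) (use j assms residue_seq_stays_zero in auto)
    from this[of "i - j"] show False using that by simp
  qed
  define N where "N = (LEAST i. residue_seq a b i = 0)"
  have "\<exists>i. i \<notin> ?S" using fin by (meson ex_new_if_finite infinite_UNIV_nat)
  then have "\<exists>i. residue_seq a b i = 0" using residue_seq_nonneg[of a b] by (auto simp: order.strict_iff_order)
  then have N: "residue_seq a b N = 0" unfolding N_def by (rule LeastI_ex)
  have "?S = {..<N}"
  proof (intro equalityI subsetI)
    fix i assume "i \<in> ?S" then show "i \<in> {..<N}" using down[of i N] N by (auto simp: not_le[symmetric])
  next
    fix i assume "i \<in> {..<N}"
    then have "residue_seq a b i \<noteq> 0" unfolding N_def using not_less_Least by auto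
    then show "i \<in> ?S" using residue_seq_nonneg[of a b i] by simp
  qed
  then show ?thesis unfolding F_def by auto
qed

lemma residue_seq_dvd:
  assumes "residue_seq a b (Suc i) > 0"
  shows "residue_seq a b (Suc i) dvd residue_seq a b i + residue_seq a b (Suc (Suc i))"
proof -
  have "residue_seq a b (Suc i) dvd (- residue_seq a b i) mod residue_seq a b (Suc i) - (- residue_seq a b i)"
    by (rule mod_eq_dvd_iff[THEN iffD1]) simp
  then show ?thesis using assms by (simp add: add.commute)
qed

text \<open>Each step preserves the gcd of neighbouring terms. At the last positive term the
  neighbour is 0, which forces that term to be 1.\<close>

lemma residue_seq_coprime:
  assumes "coprime a b"
  shows "i < F a b \<Longrightarrow> 0 < b \<Longrightarrow> b < a \<Longrightarrow> coprime (residue_seq a b i) (residue_seq a b (Suc i))"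
proof (induction i)
  case 0 then show ?case using assms by simp
next
  case (Suc i)
  then have "residue_seq a b (Suc i) > 0" using residue_seq_pos_iff[of b a "Suc i"] by simp
  then have "residue_seq a b (Suc (Suc i)) = (- residue_seq a b i) mod residue_seq a b (Suc i)" by simp
  then have "gcd (residue_seq a b (Suc i)) (residue_seq a b (Suc (Suc i)))
      = gcd (residue_seq a b i) (residue_seq a b (Suc i))"
    by (metis gcd.commute gcd_neg1_int gcd_red_int)
  then show ?case using Suc by (simp add: coprime_iff_gcd_eq_1)
qed

theorem theorem5p9:
  fixes m k r n :: nat
  assumes "m \<ge> 2" and "k \<ge> 2" and "coprime m k"
    and "r = m mod k"
    and "n = m - m div k + F k (k - r)"
  shows "\<exists>d \<rho>. smooth_bident_structure n d \<rho> \<and>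
           order (critical_group (bident_verts n) (bident_edges n) d) = m"
proof -
  define b where "b = k - r"
  define x where "x = residue_seq k b"
  define J where "J = m - m div k"
  define f where "f = F k b"
  have gcd_r: "gcd k r = 1"
    using assms gcd_red_nat[of m k] by (simp add: coprime_iff_gcd_eq_1)
  then have "r \<noteq> 0" using assms(2) by (intro notI) simp
  moreover have "r < k" using assms by simp
  ultimately have b: "0 < b" "b < k" "int b = int k - int r" by (auto simp: b_def)
  have cop: "coprime k b"
    unfolding b_def coprime_iff_gcd_eq_1
    using gcd_diff2_nat[of r k] gcd_r \<open>r < k\<close> by (simp add: gcd.commute)
  have xpos: "x i > 0 \<longleftrightarrow> i < f" for i using residue_seq_pos_iff[OF b(1,2)] by (simp add: x_def f_def)
  have f2: "f \<ge> 2" using xpos[of 1] b by (simp add: x_def)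
  have x01: "x 0 = int k" "x 1 = int b" by (simp_all add: x_def)
  have xf: "x f = 0" using xpos[of f] residue_seq_nonneg[of k b f] by (simp add: x_def)
  have xlast: "x (f - 1) = 1"
    using residue_seq_coprime[OF cop, of "f - 1"] xpos[of "f - 1"] xf f2 b
    by (simp add: x_def f_def)
  have div: "m div k \<le> m div 2" using assms by (simp add: div_le_mono2)
  \<comment> \<open>For \<open>m = 2\<close> coprimality excludes \<open>k = 2\<close>, so
    \<open>m div k = 0\<close>; for larger \<open>m\<close> the bound by \<open>m div 2\<close>
    suffices.\<close>
  have J2: "J \<ge> 2"
  proof (cases "m = 2")
    case True
    then have "k > 2" using assms by (cases "k = 2") auto
    then show ?thesis using True by (simp add: J_def)
  qed (use div assms in \<open>simp add: J_def; linarith\<close>)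
  \<comment> \<open>Equivalently, the progression starting at \<open>m * (k - 1)\<close> with step
    \<open>- k\<close> has the value \<open>k - r = b\<close> at index \<open>J - 1\<close>.\<close>
  have Jk: "int J * int k = int m * int k - int m + int r"
  proof -
    have "int m = int k * int (m div k) + int r"
      unfolding assms(4) by (metis mult_div_mod_eq of_nat_add of_nat_mult)
    then have "int m * int k - int J * int k = int m - int r"
      by (simp add: J_def of_nat_diff algebra_simps)
    then show ?thesis by simp
  qed
  define s where "s i = (if i < J then int m * (int k - 1) - int i * int k else x (i + 2 - J))" for i
  \<comment> \<open>The arithmetic progression ends with the two values \<open>k + x\<^sub>1\<close>, \<open>x\<^sub>1\<close>, so that modulo \<open>x\<^sub>1\<close> it
    continues like \<open>x\<close>.\<close>
  have s_join: "s (J - 1 + i) = x (1 + i)" for i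
  proof (cases i)
    case 0
    have "int (J - 1) = int J - 1" using J2 by simp
    then show ?thesis using 0 J2 Jk b(3) x01 by (simp add: s_def algebra_simps)
  next
    case (Suc j) then show ?thesis using J2 by (simp add: s_def)
  qed
  have s_arith: "s i = int b + int (J - 1 - i) * int k" if "i < J" for i
  proof -
    have "int (J - 1 - i) = int J - 1 - int i" using that by simp
    then show ?thesis using that Jk b(3) by (simp add: s_def algebra_simps)
  qed
  \<comment> \<open>The tail has \<open>n - 2\<close> entries: \<open>J\<close> from the
    progression, the last being \<open>x 1\<close>, then the \<open>f - 2\<close> terms
    \<open>x 2\<close> to \<open>x (f - 1)\<close>.\<close>
  have n: "n = J + f" using assms by (simp add: J_def f_def b_def)
  have "\<exists>d \<rho>. smooth_bident_structure n d \<rho> \<and>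
           order (critical_group (bident_verts n) (bident_edges n) d) = nat (int m)"
  \<comment> \<open>With \<open>a = k - 1\<close> the drop from \<open>s 0\<close> to
    \<open>s 1\<close> is \<open>k = a + 1\<close>, the sum of the leaf entries.\<close>
  proof (rule smooth_bident_structure_from_sequence[where s = s and a = "int k - 1"])
    show "n \<ge> 4" "int k - 1 > 0" "int m \<ge> 2" "s 0 = int m * (int k - 1)"
      "s 0 = int k - 1 + 1 + s 1"
      using n f2 J2 assms by (simp_all add: s_def)
    have e: "n - 3 = J - 1 + (f - 2)" "Suc (n - 3) = J - 1 + (f - 1)" using n f2 J2 by auto
    show "s (n - 3) = 1" unfolding e(1) s_join using xlast f2 by (simp add: Suc_diff_Suc numeral_2_eq_2)
    show "s (Suc (n - 3)) = 0" unfolding e(2) s_join using xf f2 by simp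
    show "s i > 0" if "i \<le> n - 3" for i
    proof (cases "i < J")
      case True then show ?thesis using s_arith b by (simp add: add_pos_nonneg)
    next
      case False
      then show ?thesis using s_join[of "i - (J - 1)"] xpos that n J2 f2 by auto
    qed
    fix i assume i: "i < n - 3"
    \<comment> \<open>Three consecutive entries lie in the progression, where the outer two sum to
      twice the middle one; or straddle the join with middle entry \<open>x 1\<close>; or all come
      from \<open>x\<close>.\<close>
    consider (arith) "i + 2 < J" | (join) "i + 2 = J" | (tail) j where "i = J - 1 + j" "j + 2 < f"
    proof (cases "i + 2 \<le> J")
      case False
      then have "i = J - 1 + (i - (J - 1))" "i - (J - 1) + 2 < f" using i n J2 f2 by auto
      then show thesis using that(3) by blast
    qed (use that in linarith)
    then have "s (Suc i) < s i \<and> s (Suc i) dvd s i + s (Suc (Suc i))"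
    proof cases
      case arith
      then have "s i = s (Suc i) + int k" "s (Suc (Suc i)) = s (Suc i) - int k"
        by (simp_all add: s_def algebra_simps)
      then show ?thesis using b by simp
    next
      case join
      then have J: "J - 1 = Suc i" "i < J" by auto
      then have "s i = x 1 + x 0" using s_arith[of i] x01 by simp
      moreover have "s (Suc i) = x 1" "s (Suc (Suc i)) = x 2"
        using s_join[of 0] s_join[of 1] unfolding J(1) by (simp_all add: numeral_2_eq_2)
      moreover have "x 1 dvd x 0 + x 2"
        using residue_seq_dvd[of k b 0] b by (simp add: x_def numeral_2_eq_2)
      ultimately show ?thesis using x01(1) b(2) by (simp add: add.assoc)
    next
      case tail
      have "s i = x (Suc j)" "s (Suc i) = x (Suc (Suc j))" "s (Suc (Suc i)) = x (Suc (Suc (Suc j)))"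
        using s_join[of j] s_join[of "Suc j"] s_join[of "Suc (Suc j)"] tail by simp_all
      then show ?thesis
        using residue_seq_dvd[of k b "Suc j", folded x_def]
          residue_seq_decreasing[OF b(2), of "Suc j", folded x_def]
          xpos[of "Suc j"] xpos[of "Suc (Suc j)"] tail by simp
    qed
    then show "s (Suc i) < s i" "s (Suc i) dvd s i + s (Suc (Suc i))" by blast+
  qed
  then show ?thesis by simp
qed

end
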